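(* Let $k \ge 3$, $3 \le m \le n$ and $k+1 < n$. Let $r = m \bmod (k+1)$ and $s = n \bmod (k+1)$ (remainders in $\{0,\dots,k\}$). Then $$d_k(P_m \boxtimes P_n) \le \begin{cases} (m+1)\frac{n}{k+1} & \text{if } s = 0,\\[2pt] (m+1)\left\lfloor \frac{n}{k+1}\right\rfloor + \left\lceil \frac{m}{k+1}\right\rceil & \text{if } s = 1,\\[2pt] (m+1)\left\lfloor \frac{n}{k+1}\right\rfloor + 4\left\lfloor \frac{m}{k+1}\right\rfloor + d_k(P_r \boxtimes P_s) & \text{if } s = 2,\\[2pt] (m+1)\left\lfloor \frac{n}{k+1}\right\rfloor + (s+1)\left\lfloor \frac{m}{k+1}\right\rfloor + d_k(P_r \boxtimes P_s) & \text{if } s \ge 3, \end{cases}$$ where by convention $d_k(P_0 \boxtimes P_s) = 0$.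
   Context: $P_n$ is the path on $n$ vertices ($P_1$ is a single vertex, so $P_1 \boxtimes P_s \cong P_s$). $P_m \boxtimes P_n$ is the strong product (strong grid): vertices $(i,j)$, $0\le i\le m-1$, $0\le j\le n-1$, with distinct $(i,j)$, $(i',j')$ adjacent iff $|i-i'|\le 1$ and $|j-j'|\le 1$. The $k$-move deduction game ($k$ a positive integer) on a finite graph $G$: a layout places a finite number of searchers on vertices of $G$ (several searchers may share a vertex). Every searcher is initially mobile. A vertex is protected once it has been occupied by some searcher (so initially occupied vertices are protected); other vertices are unprotected. The game proceeds in stages. At each stage, for every vertex $v$ that has at least one unprotected neighbour: if the number of mobile searchers on $v$ is at least the number of unprotected neighbours of $v$, then the mobile searchers on $v$ move to the unprotected neighbours of $v$ so that each unprotected neighbour receives at least one searcher; excess mobile searchers on $v$ may also move to any of these unprotected neighbours. All moves in a stage happen simultaneously, newly occupied vertices become protected, and a searcher that has moved $k$ times becomes immobile. The process repeats until all vertices are protected or no searcher can move. A layout is successful if all vertices of $G$ end up protected. The $k$-move deduction number $d_k(G)$ is the minimum number of searchers in a successful layout on $G$. *)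

theory Defs
  imports Complex_Main
begin

record 'v graph =
  verts :: "'v set"
  adj :: "'v \<Rightarrow> 'v \<Rightarrow> bool"

definition path_graph :: "nat \<Rightarrow> nat graph" where
  "path_graph n =
     \<lparr>verts = {..<n}, adj = (\<lambda>i j. i < n \<and> j < n \<and> (j = Suc i \<or> i = Suc j))\<rparr>"

definition strong_product :: "'a graph \<Rightarrow> 'b graph \<Rightarrow> ('a \<times> 'b) graph"  (infixl \<open>\<boxtimes>\<close> 70) where
  "G \<boxtimes> H =
     \<lparr>verts = verts G \<times> verts H,
      adj = (\<lambda>(a, b) (a', b').
               a \<in> verts G \<and> a' \<in> verts G \<and> b \<in> verts H \<and> b' \<in> verts H \<and>
               (a, b) \<noteq> (a', b') \<and> (a = a' \<or> adj G a a') \<and> (b = b' \<or> adj H b b'))\<rparr>"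

lemma verts_strong_grid [simp]:
  "verts (path_graph m \<boxtimes> path_graph n) = {..<m} \<times> {..<n}"
  by (simp add: path_graph_def strong_product_def)

lemma adj_strong_grid:
  "adj (path_graph m \<boxtimes> path_graph n) (i, j) (i', j') \<longleftrightarrow>
     i < m \<and> i' < m \<and> j < n \<and> j' < n \<and> (i, j) \<noteq> (i', j') \<and>
     \<bar>int i - int i'\<bar> \<le> 1 \<and> \<bar>int j - int j'\<bar> \<le> 1"
  by (auto simp: path_graph_def strong_product_def)

text \<open>
  The searchers are numbered; a game with \<open>N\<close> searchers uses the numbers below \<open>N\<close>, and the
  values of \<open>pos\<close> and \<open>moves\<close> at other numbers are irrelevant.
\<close>

record 'v game_state =
  pos :: "nat \<Rightarrow> 'v"
  moves :: "nat \<Rightarrow> nat"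
  protected :: "'v set"

definition unprotected_nbrs :: "'v graph \<Rightarrow> 'v game_state \<Rightarrow> 'v \<Rightarrow> 'v set" where
  "unprotected_nbrs G S v = {w \<in> verts G. adj G v w \<and> w \<notin> protected S}"

definition mobile_on :: "nat \<Rightarrow> nat \<Rightarrow> 'v game_state \<Rightarrow> 'v \<Rightarrow> nat set" where
  "mobile_on k N S v = {i. i < N \<and> pos S i = v \<and> moves S i < k}"

definition fires :: "nat \<Rightarrow> nat \<Rightarrow> 'v graph \<Rightarrow> 'v game_state \<Rightarrow> 'v \<Rightarrow> bool" where
  "fires k N G S v \<longleftrightarrow>
     v \<in> verts G \<and> unprotected_nbrs G S v \<noteq> {} \<and>
     card (unprotected_nbrs G S v) \<le> card (mobile_on k N S v)"

text \<open>
  One stage. All vertices that can fire must do so, simultaneously: whether a vertex fires is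
  judged on the state \<open>S\<close> before the stage. The relation is not functional, since it is left open
  which searcher goes to which unprotected neighbour, and how many of the excess searchers stay.
\<close>

definition stage :: "nat \<Rightarrow> nat \<Rightarrow> 'v graph \<Rightarrow> 'v game_state \<Rightarrow> 'v game_state \<Rightarrow> bool" where
  "stage k N G S S' \<longleftrightarrow>
     (\<forall>i<N. (pos S' i = pos S i \<and> moves S' i = moves S i) \<or>
            (fires k N G S (pos S i) \<and> i \<in> mobile_on k N S (pos S i) \<and>
             pos S' i \<in> unprotected_nbrs G S (pos S i) \<and> moves S' i = Suc (moves S i))) \<and>
     (\<forall>v. fires k N G S v \<longrightarrow>
            (\<forall>w\<in>unprotected_nbrs G S v. \<exists>i\<in>mobile_on k N S v. pos S' i = w)) \<and>
     protected S' = protected S \<union> pos S' ` {..<N}"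

definition is_layout :: "nat \<Rightarrow> 'v graph \<Rightarrow> (nat \<Rightarrow> 'v) \<Rightarrow> bool" where
  "is_layout N G L \<longleftrightarrow> (\<forall>i<N. L i \<in> verts G)"

definition initial_state :: "nat \<Rightarrow> (nat \<Rightarrow> 'v) \<Rightarrow> 'v game_state" where
  "initial_state N L = \<lparr>pos = L, moves = (\<lambda>_. 0), protected = L ` {..<N}\<rparr>"

text \<open>
  The searchers choose their moves, so a layout is successful if some play protects every vertex.
  When no vertex fires, \<open>stage\<close> changes no relevant part of the state, so the stopping condition
  of the game needs no separate treatment.
\<close>

definition successful :: "nat \<Rightarrow> nat \<Rightarrow> 'v graph \<Rightarrow> (nat \<Rightarrow> 'v) \<Rightarrow> bool" where
  "successful k N G L \<longleftrightarrow>
     is_layout N G L \<and>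
     (\<exists>S. (stage k N G)\<^sup>*\<^sup>* (initial_state N L) S \<and> verts G \<subseteq> protected S)"

definition deduction_number :: "nat \<Rightarrow> 'v graph \<Rightarrow> nat" where
  "deduction_number k G = (LEAST N. \<exists>L. successful k N G L)"

text \<open>On a finite graph the minimum exists, as one may start with a searcher on every vertex.\<close>

lemma successful_exists:
  assumes "finite (verts G)"
  shows "\<exists>N L. successful k N G L"
proof -
  obtain L where "bij_betw L {0..<card (verts G)} (verts G)"
    using ex_bij_betw_nat_finite[OF assms] by blast
  then have L: "L ` {..<card (verts G)} = verts G"
    by (simp add: bij_betw_def atLeast0LessThan)
  then have "is_layout (card (verts G)) G L"
    by (auto simp: is_layout_def)
  moreover have "verts G \<subseteq> protected (initial_state (card (verts G)) L)"
    using L by (simp add: initial_state_def)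
  ultimately show ?thesis
    unfolding successful_def by blast
qed

text \<open>The convention for the graph without vertices is a consequence of the definitions.\<close>

lemma deduction_number_empty [simp]:
  "deduction_number k (path_graph 0 \<boxtimes> path_graph s) = 0"
proof -
  have "successful k 0 (path_graph 0 \<boxtimes> path_graph s) L" for L
    by (auto simp: successful_def is_layout_def)
  then show ?thesis
    unfolding deduction_number_def by (metis Least_eq_0)
qed

end

theory Submission
  imports Defs
begin

text \<open>
  It suffices to compare a grid with the one obtained by appending \<open>k + 1\<close> columns. If every vertex
  of the first new column is occupied from the start, then the searchers on the old part never see
  an unprotected vertex outside it, so any play of the smaller grid carries over unchanged. The new
  columns are then swept by a wave of \<open>a + 1\<close> searchers on \<open>a \<ge> 3\<close> rows: a pair at one corner
  fires, after which the vertices below it fire one by one, each into the next row of the next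
  column; the last two vertices fire simultaneously into the opposite corner, which recreates the
  pair. With two rows two pairs advance in parallel, and one row is a path. Appending strips in both
  directions reduces \<open>m \<times> n\<close> to \<open>r \<times> s\<close>.
\<close>

section \<open>Searcher counts and optimal layouts\<close>

text \<open>Turns prescribed searcher counts into a placement: \<open>h\<close> enumerates the pairs
  \<open>(v, i)\<close> with \<open>i < c v\<close>, and each searcher stands on the first component
  of its pair.\<close>

lemma ex_fun_with_fibre_cards:
  assumes "finite D"
  shows "\<exists>f. (\<forall>t<sum c D. f t \<in> D) \<and> (\<forall>v\<in>D. card {t. t < sum c D \<and> f t = v} = (c v :: nat))"
proof -
  let ?A = "Sigma D (\<lambda>v. {..<c v})"
  have fin: "finite ?A" and card: "card ?A = sum c D"
    using assms by auto
  obtain h where h: "bij_betw h {0..<sum c D} ?A"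
    using ex_bij_betw_nat_finite[OF fin] card by auto
  have "card {t. t < sum c D \<and> fst (h t) = v} = c v" if "v \<in> D" for v
  proof -
    have "bij_betw h {t. t < sum c D \<and> fst (h t) = v} ({v} \<times> {..<c v})"
    proof (rule bij_betw_subset[OF h, THEN bij_betw_cong[THEN iffD1, rotated]])
      show "h ` {t. t < sum c D \<and> fst (h t) = v} = {v} \<times> {..<c v}"
      proof
        show "h ` {t. t < sum c D \<and> fst (h t) = v} \<subseteq> {v} \<times> {..<c v}"
          using bij_betw_apply[OF h] by fastforce
        show "{v} \<times> {..<c v} \<subseteq> h ` {t. t < sum c D \<and> fst (h t) = v}"
        proof
          fix p assume p: "p \<in> {v} \<times> {..<c v}"
          then have "p \<in> h ` {0..<sum c D}"
            using that h by (auto simp: bij_betw_def)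
          then obtain t where "t < sum c D" "p = h t"
            by auto
          then show "p \<in> h ` {t. t < sum c D \<and> fst (h t) = v}"
            using p by (intro image_eqI[of _ _ t]) auto
        qed
      qed
    qed auto
    then show ?thesis
      by (simp add: bij_betw_same_card)
  qed
  moreover have "fst (h t) \<in> D" if "t < sum c D" for t
    using bij_betw_apply[OF h, of t] that by auto
  ultimately show ?thesis
    by (intro exI[of _ "fst \<circ> h"]) auto
qed

lemma deduction_number_le:
  "successful k N G L \<Longrightarrow> deduction_number k G \<le> N"
  unfolding deduction_number_def by (rule Least_le) blast

lemma deduction_number_attained:
  assumes "finite (verts G)"
  obtains L where "successful k (deduction_number k G) G L"
proof -
  have "\<exists>L. successful k (deduction_number k G) G L"
    using successful_exists[OF assms, of k] unfolding deduction_number_def by (rule LeastI_ex)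
  then show ?thesis
    using that by blast
qed

text \<open>Counts the arrivals at \<open>w\<close> when every firing vertex \<open>v\<close> sends
  its searchers, one each, onto \<open>u v\<close>. From \<open>v\<close> exactly one searcher
  reaches \<open>w\<close> if \<open>w\<close> lies in \<open>u v\<close>, and none otherwise, so
  \<open>p\<close> matches the arriving searchers with the vertices they come from.\<close>

lemma card_fibre_bij_union:
  assumes g: "\<And>v. v \<in> A \<Longrightarrow> bij_betw (g v) {t \<in> T. p t = v} (u v)"
  shows "card {t \<in> T. p t \<in> A \<and> g (p t) t = w} = card {v \<in> A. w \<in> u v}"
proof -
  have "bij_betw p {t \<in> T. p t \<in> A \<and> g (p t) t = w} {v \<in> A. w \<in> u v}"
    unfolding bij_betw_def
  proof
    show "inj_on p {t \<in> T. p t \<in> A \<and> g (p t) t = w}"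
    proof (rule inj_onI)
      fix s t
      assume st: "s \<in> {t \<in> T. p t \<in> A \<and> g (p t) t = w}"
        "t \<in> {t \<in> T. p t \<in> A \<and> g (p t) t = w}" "p s = p t"
      then have "inj_on (g (p t)) {t' \<in> T. p t' = p t}"
        using g by (auto simp: bij_betw_def)
      then show "s = t"
        using st by (auto dest: inj_onD)
    qed
    show "p ` {t \<in> T. p t \<in> A \<and> g (p t) t = w} = {v \<in> A. w \<in> u v}"
    proof
      show "p ` {t \<in> T. p t \<in> A \<and> g (p t) t = w} \<subseteq> {v \<in> A. w \<in> u v}"
        using bij_betw_apply[OF g] by fastforce
      show "{v \<in> A. w \<in> u v} \<subseteq> p ` {t \<in> T. p t \<in> A \<and> g (p t) t = w}"
      proof
        fix v assume v: "v \<in> {v \<in> A. w \<in> u v}"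
        then have "w \<in> g v ` {t \<in> T. p t = v}"
          using g[of v] by (auto simp: bij_betw_def)
        then show "v \<in> p ` {t \<in> T. p t \<in> A \<and> g (p t) t = w}"
          using v by auto
      qed
    qed
  qed
  then show ?thesis
    by (rule bij_betw_same_card)
qed

section \<open>Extending plays from a subgraph to a larger graph\<close>

text \<open>
  The new part \<open>D\<close> of \<open>G\<close> runs through states \<open>z\<close> with protected vertices \<open>P z\<close>, searcher counts \<open>c z\<close>
  and vertices \<open>F z\<close> that fire next, once their neighbours in \<open>H\<close> are protected. Every searcher on a
  vertex \<open>v\<close> of \<open>D\<close> has made \<open>level v\<close> moves. The set \<open>R z\<close> consists of vertices of \<open>H\<close> known to be
  protected in state \<open>z\<close>; the condition \<open>gate\<close> says that given these, all of \<open>F z\<close> becomes ready at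
  the same moment, whatever happens in \<open>H\<close>.
\<close>

locale block_extension =
  fixes k :: nat and H G :: "'v graph" and Z :: "'z set" and z0 :: 'z
    and P :: "'z \<Rightarrow> 'v set" and c :: "'z \<Rightarrow> 'v \<Rightarrow> nat" and F R :: "'z \<Rightarrow> 'v set"
    and nx :: "'z \<Rightarrow> 'z" and level :: "'v \<Rightarrow> nat"
    and D :: "'v set" and old :: "'v \<Rightarrow> 'v set" and new :: "'z \<Rightarrow> 'v \<Rightarrow> 'v set"
  defines "D \<equiv> verts G - verts H"
    and "old \<equiv> \<lambda>v. {w \<in> verts H. adj G v w}"
    and "new \<equiv> \<lambda>z v. {w \<in> D. adj G v w \<and> w \<notin> P z}"
  assumes finite_verts: "finite (verts G)"
    and sub: "verts H \<subseteq> verts G"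
    and induced: "\<And>v w. v \<in> verts H \<Longrightarrow> w \<in> verts H \<Longrightarrow> adj H v w = adj G v w"
    and start: "z0 \<in> Z" "R z0 = {}" "P z0 = {v \<in> D. 0 < c z0 v}"
      "\<And>v. v \<in> D \<Longrightarrow> 0 < c z0 v \<Longrightarrow> level v = 0"
    and attach: "\<And>z v w. z \<in> Z \<Longrightarrow> v \<in> verts H \<Longrightarrow> w \<in> D \<Longrightarrow> adj G v w \<Longrightarrow> w \<in> P z"
    and P_sub: "\<And>z. z \<in> Z \<Longrightarrow> P z \<subseteq> D"
    and occupied: "\<And>z v. z \<in> Z \<Longrightarrow> v \<in> D \<Longrightarrow> 0 < c z v \<Longrightarrow> v \<in> P z"
    and F_sub: "\<And>z. z \<in> Z \<Longrightarrow> F z \<subseteq> D"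
    and F_level: "\<And>z v. z \<in> Z \<Longrightarrow> v \<in> F z \<Longrightarrow> level v < k"
    and F_new: "\<And>z v. z \<in> Z \<Longrightarrow> v \<in> F z \<Longrightarrow> new z v \<noteq> {}"
    and F_card: "\<And>z v. z \<in> Z \<Longrightarrow> v \<in> F z \<Longrightarrow> card (new z v) = c z v"
    and new_level: "\<And>z v w. z \<in> Z \<Longrightarrow> v \<in> F z \<Longrightarrow> w \<in> new z v \<Longrightarrow> level w = Suc (level v)"
    and gate: "\<And>z v v'. z \<in> Z \<Longrightarrow> v \<in> F z \<Longrightarrow> v' \<in> F z \<Longrightarrow> old v \<subseteq> R z \<union> old v'"
    and idle: "\<And>z v. z \<in> Z \<Longrightarrow> v \<in> D \<Longrightarrow> v \<notin> F z \<Longrightarrow>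
      k \<le> level v \<or> c z v < card (new z v) \<or> c z v = 0 \<or> (new z v = {} \<and> old v = {})"
    and nx_in: "\<And>z. z \<in> Z \<Longrightarrow> F z \<noteq> {} \<Longrightarrow> nx z \<in> Z"
    and nx_R: "\<And>z. z \<in> Z \<Longrightarrow> F z \<noteq> {} \<Longrightarrow> R (nx z) \<subseteq> R z \<union> (\<Union>v\<in>F z. old v)"
    and nx_P: "\<And>z. z \<in> Z \<Longrightarrow> F z \<noteq> {} \<Longrightarrow> P (nx z) = P z \<union> (\<Union>v\<in>F z. new z v)"
    and nx_c: "\<And>z w. z \<in> Z \<Longrightarrow> F z \<noteq> {} \<Longrightarrow> w \<in> D \<Longrightarrow> c (nx z) w =
      (if w \<in> P z then (if w \<in> F z then 0 else c z w) else card {v \<in> F z. w \<in> new z v})"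
    and finished: "\<And>z. z \<in> Z \<Longrightarrow> F z = {} \<Longrightarrow> P z = D"
begin

text \<open>The simulation invariant between a state \<open>S\<close> of the play on
  \<open>H\<close> and a state \<open>C\<close> of the play on \<open>G\<close>. Searchers below
  \<open>N\<close> behave identically in both. The further ones are recorded only through their
  number on each vertex: those sharing a vertex have made equally many moves and are
  interchangeable. About the progress on \<open>H\<close>, \<open>z\<close> knows only
  \<open>R z\<close>.\<close>

definition follows :: "nat \<Rightarrow> 'v game_state \<Rightarrow> 'v game_state \<Rightarrow> 'z \<Rightarrow> bool" where
  "follows N C S z \<longleftrightarrow>
     z \<in> Z \<and> R z \<subseteq> protected S \<and> protected S \<subseteq> verts H \<and> protected C = protected S \<union> P z \<and>
     (\<forall>t<N. pos C t = pos S t \<and> moves C t = moves S t \<and> pos S t \<in> verts H) \<and>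
     (\<forall>t\<in>{N..<N + sum (c z0) D}. pos C t \<in> D \<and> moves C t = level (pos C t)) \<and>
     (\<forall>v\<in>D. card {t \<in> {N..<N + sum (c z0) D}. pos C t = v} = c z v)"

lemma finite_D: "finite D"
  using finite_verts by (simp add: D_def)

text \<open>By \<open>attach\<close>, no vertex of \<open>H\<close> ever sees an unprotected vertex
  of \<open>D\<close>, so a stage on \<open>H\<close> lifts to \<open>G\<close>; in the lifted stage
  either all of \<open>F z\<close> fires or nothing in \<open>D\<close> does. The last conclusion
  says that a protected \<open>H\<close> can no longer delay \<open>F z\<close>; it yields
  termination later.\<close>

lemma follows_step:
  assumes st: "stage k N H S S'" and fo: "follows N C S z"
  shows "\<exists>C' z'. stage k (N + sum (c z0) D) G C C' \<and> follows N C' S' z' \<and>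
           (verts H \<subseteq> protected S \<longrightarrow> F z \<noteq> {} \<longrightarrow> z' = nx z)"
proof -
  let ?M = "N + sum (c z0) D"
  let ?T = "{N..<?M}"
  have z: "z \<in> Z" and Rz: "R z \<subseteq> protected S" and protS: "protected S \<subseteq> verts H"
    and protC: "protected C = protected S \<union> P z"
    and posH: "\<And>t. t < N \<Longrightarrow> pos C t = pos S t \<and> moves C t = moves S t \<and> pos S t \<in> verts H"
    and posD: "\<And>t. t \<in> ?T \<Longrightarrow> pos C t \<in> D \<and> moves C t = level (pos C t)"
    and cnt: "\<And>v. v \<in> D \<Longrightarrow> card {t \<in> ?T. pos C t = v} = c z v"
    using fo unfolding follows_def by auto
  have disj: "v \<notin> D" if "v \<in> verts H" for v
    using that by (simp add: D_def)
  \<comment> \<open>The vertices of \<open>D\<close> that fire in this stage. All or nothing is the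
    right choice because, by \<open>gate\<close>, the vertices of \<open>F z\<close> get their last
    neighbour in \<open>H\<close> protected simultaneously.\<close>
  define A where "A = (if \<forall>v\<in>F z. old v \<subseteq> protected S then F z else {})"
  have A_F: "A \<subseteq> F z"
    by (simp add: A_def)
  then have A_D: "A \<subseteq> D"
    using F_sub[OF z] by auto
  have unH: "unprotected_nbrs G C v = unprotected_nbrs H S v" if v: "v \<in> verts H" for v
  proof -
    have "w \<in> verts G \<and> adj G v w \<and> w \<notin> protected S \<union> P z \<longleftrightarrow>
          w \<in> verts H \<and> adj H v w \<and> w \<notin> protected S" for w
      using attach[OF z v, of w] P_sub[OF z] induced[OF v, of w] sub
      by (auto simp: D_def)
    then show ?thesis
      by (simp add: unprotected_nbrs_def protC)
  qed
  have unD: "unprotected_nbrs G C v = new z v \<union> (old v - protected S)" if v: "v \<in> D" for v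
    using sub protS P_sub[OF z] by (auto simp: unprotected_nbrs_def new_def old_def protC D_def)
  have mobH: "mobile_on k ?M C v = mobile_on k N S v" if v: "v \<in> verts H" for v
  proof -
    have "t < ?M \<and> pos C t = v \<and> moves C t < k \<longleftrightarrow> t < N \<and> pos S t = v \<and> moves S t < k" for t
      using posH[of t] posD[of t] disj[OF v] by (cases "t < N") auto
    then show ?thesis
      by (simp add: mobile_on_def)
  qed
  have mobD: "mobile_on k ?M C v = (if level v < k then {t \<in> ?T. pos C t = v} else {})"
    if v: "v \<in> D" for v
  proof -
    have "t < ?M \<and> pos C t = v \<and> moves C t < k \<longleftrightarrow> level v < k \<and> t \<in> ?T \<and> pos C t = v" for t
      using posH[of t] posD[of t] v disj[of v] by (cases "t < N") auto
    then show ?thesis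
      by (auto simp: mobile_on_def)
  qed
  have fireH: "fires k ?M G C v \<longleftrightarrow> fires k N H S v" if "v \<in> verts H" for v
    using that sub by (auto simp: fires_def unH mobH)
  have unA: "unprotected_nbrs G C v = new z v" if "v \<in> A" for v
  proof -
    have "old v \<subseteq> protected S"
      using that by (auto simp: A_def split: if_splits)
    then show ?thesis
      using unD[of v] that A_D by auto
  qed
  have finu: "finite (unprotected_nbrs G C v)" for v
    using finite_verts by (auto simp: unprotected_nbrs_def)
  have fireD: "fires k ?M G C v \<longleftrightarrow> v \<in> A" if v: "v \<in> D" for v
  proof
    assume v': "v \<in> A"
    then have "v \<in> F z"
      using A_F by auto
    then have "mobile_on k ?M C v = {t \<in> ?T. pos C t = v}" and "card (new z v) = c z v"
      and "new z v \<noteq> {}"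
      using F_level[OF z] F_card[OF z] F_new[OF z] by (simp_all add: mobD[OF v])
    moreover have "v \<in> verts G"
      using v by (simp add: D_def)
    ultimately show "fires k ?M G C v"
      using cnt[OF v] by (simp add: fires_def unA[OF v'])
  next
    assume f: "fires k ?M G C v"
    then have lev: "level v < k" and ne: "unprotected_nbrs G C v \<noteq> {}"
      and le: "card (unprotected_nbrs G C v) \<le> c z v"
      using cnt[OF v] by (auto simp: fires_def mobD[OF v] finu split: if_splits)
    have pos: "0 < card (unprotected_nbrs G C v)"
      using ne finu by (simp add: card_gt_0_iff)
    have le': "card (new z v) \<le> card (unprotected_nbrs G C v)"
      using unD[OF v] by (intro card_mono finu) auto
    have vF: "v \<in> F z"
    proof (rule ccontr)
      assume "v \<notin> F z"
      then have "new z v = {} \<and> old v = {}"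
        using idle[OF z v] lev le le' pos by linarith
      then show False
        using ne unD[OF v] by auto
    qed
    \<comment> \<open>By \<open>F_card\<close> the searchers on \<open>v\<close> match its
      unprotected neighbours in \<open>D\<close> exactly, so a single further unprotected neighbour
      in \<open>H\<close> would keep \<open>v\<close> from firing.\<close>
    have "old v \<subseteq> protected S"
    proof (rule ccontr)
      assume "\<not> old v \<subseteq> protected S"
      then have "new z v \<subset> unprotected_nbrs G C v"
        using unD[OF v] by (auto simp: new_def old_def D_def)
      then have "card (new z v) < card (unprotected_nbrs G C v)"
        by (intro psubset_card_mono finu)
      then show False
        using le F_card[OF z vF] by simp
    qed
    then show "v \<in> A"
      using gate[OF z _ vF] Rz vF by (auto simp: A_def)
  qed
  \<comment> \<open>Since the counts agree exactly, there are no excess searchers, and each new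
    neighbour of \<open>v\<close> receives precisely one searcher from \<open>v\<close>.\<close>
  have "\<forall>v\<in>A. \<exists>g. bij_betw g {t \<in> ?T. pos C t = v} (new z v)"
  proof
    fix v assume v: "v \<in> A"
    have "finite (new z v)"
      using finite_D by (simp add: new_def)
    moreover have "card {t \<in> ?T. pos C t = v} = card (new z v)"
      using cnt[OF subsetD[OF A_D v]] F_card[OF z subsetD[OF A_F v]] by simp
    ultimately show "\<exists>g. bij_betw g {t \<in> ?T. pos C t = v} (new z v)"
      by (intro finite_same_card_bij) auto
  qed
  then obtain g where g: "\<And>v. v \<in> A \<Longrightarrow> bij_betw (g v) {t \<in> ?T. pos C t = v} (new z v)"
    by metis
  have g_new: "g (pos C t) t \<in> new z (pos C t)" if "t \<in> ?T" "pos C t \<in> A" for t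
    using bij_betw_apply[OF g[OF that(2)], of t] that by auto
  define z' where "z' = (if A = {} then z else nx z)"
  define C' where "C' = \<lparr>pos = (\<lambda>t. if t < N then pos S' t
        else if pos C t \<in> A then g (pos C t) t else pos C t),
      moves = (\<lambda>t. if t < N then moves S' t
        else if pos C t \<in> A then Suc (moves C t) else moves C t),
      protected = protected S' \<union> P z'\<rparr>"
  have protS': "protected S' = protected S \<union> pos S' ` {..<N}"
    using st by (simp add: stage_def)
  have stH: "(pos S' t = pos S t \<and> moves S' t = moves S t) \<or>
      (fires k N H S (pos S t) \<and> t \<in> mobile_on k N S (pos S t) \<and>
       pos S' t \<in> unprotected_nbrs H S (pos S t) \<and> moves S' t = Suc (moves S t))" if "t < N" for t
    using st that unfolding stage_def by blast
  have z': "z' \<in> Z" and Pz': "P z' = P z \<union> (\<Union>v\<in>A. new z v)"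
    and Rz': "R z' \<subseteq> R z \<union> (\<Union>v\<in>A. old v)"
    and cz': "\<And>w. w \<in> D \<Longrightarrow> c z' w =
      (if w \<in> P z then (if w \<in> A then 0 else c z w) else card {v \<in> A. w \<in> new z v})"
  proof -
    \<comment> \<open>If nothing in \<open>D\<close> fires, \<open>z\<close> is kept, and the update
      rule for counts then demands zero on unprotected vertices; this is where that is
      supplied.\<close>
    have cz: "c z w = 0" if "w \<in> D" "w \<notin> P z" for w
      using occupied[OF z that(1)] that(2) by auto
    have "z' \<in> Z \<and> P z' = P z \<union> (\<Union>v\<in>A. new z v) \<and> R z' \<subseteq> R z \<union> (\<Union>v\<in>A. old v) \<and>
      (\<forall>w\<in>D. c z' w =
        (if w \<in> P z then (if w \<in> A then 0 else c z w) else card {v \<in> A. w \<in> new z v}))"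
    proof (cases "A = {}")
      case True
      then show ?thesis
        using z cz by (simp add: z'_def)
    next
      case False
      then have "A = F z"
        unfolding A_def by presburger
      then show ?thesis
        using False nx_in[OF z] nx_P[OF z] nx_R[OF z] nx_c[OF z] by (simp add: z'_def)
    qed
    then show "z' \<in> Z" "P z' = P z \<union> (\<Union>v\<in>A. new z v)" "R z' \<subseteq> R z \<union> (\<Union>v\<in>A. old v)"
      "\<And>w. w \<in> D \<Longrightarrow> c z' w =
      (if w \<in> P z then (if w \<in> A then 0 else c z w) else card {v \<in> A. w \<in> new z v})"
      by blast+
  qed
  have split: "{..<?M} = {..<N} \<union> ?T"
    by auto
  have posD_P: "pos C t \<in> P z" if t: "t \<in> ?T" for t
  proof -
    have "0 < card {t' \<in> ?T. pos C t' = pos C t}"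
      using t by (subst card_gt_0_iff) auto
    then show ?thesis
      using occupied[OF z, of "pos C t"] cnt[of "pos C t"] posD[OF t] by simp
  qed
  have img: "pos C' ` {..<N} = pos S' ` {..<N}"
    by (auto simp: C'_def)
  have imgD: "P z \<union> pos C' ` ?T = P z'"
  proof
    show "P z \<union> pos C' ` ?T \<subseteq> P z'"
      using posD_P g_new by (fastforce simp: C'_def Pz')
    show "P z' \<subseteq> P z \<union> pos C' ` ?T"
    proof
      fix w assume "w \<in> P z'"
      then consider "w \<in> P z" | v where "v \<in> A" "w \<in> new z v"
        by (auto simp: Pz')
      then show "w \<in> P z \<union> pos C' ` ?T"
      proof cases
        case 2
        then have "w \<in> g v ` {t \<in> ?T. pos C t = v}"
          using g[of v] by (auto simp: bij_betw_def)
        then obtain t where t: "t \<in> ?T" "pos C t = v" "w = g v t"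
          by auto
        then have "w = pos C' t"
          using 2 by (auto simp: C'_def)
        then show ?thesis
          using t by blast
      qed auto
    qed
  qed
  have "stage k ?M G C C'"
    unfolding stage_def
  proof (intro conjI allI impI ballI)
    fix t assume t: "t < ?M"
    show "(pos C' t = pos C t \<and> moves C' t = moves C t) \<or>
      (fires k ?M G C (pos C t) \<and> t \<in> mobile_on k ?M C (pos C t) \<and>
       pos C' t \<in> unprotected_nbrs G C (pos C t) \<and> moves C' t = Suc (moves C t))"
    proof (cases "t < N")
      case True
      then show ?thesis
        using stH[OF True] posH[OF True] by (auto simp: C'_def fireH mobH unH)
    next
      case False
      then have tT: "t \<in> ?T"
        using t by auto
      show ?thesis
      proof (cases "pos C t \<in> A")
        case True
        then have "pos C t \<in> F z" "pos C t \<in> D"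
          using A_F A_D by auto
        then show ?thesis
          using True False tT fireD g_new[OF tT True] F_level[OF z]
          by (auto simp: C'_def unA mobD)
      next
        case False
        then show ?thesis
          using \<open>\<not> t < N\<close> by (simp add: C'_def)
      qed
    qed
  next
    fix v w assume f: "fires k ?M G C v" and w: "w \<in> unprotected_nbrs G C v"
    show "\<exists>t\<in>mobile_on k ?M C v. pos C' t = w"
    proof (cases "v \<in> verts H")
      case True
      then obtain t where t: "t \<in> mobile_on k N S v" "pos S' t = w"
        using st f w unfolding stage_def by (metis fireH unH)
      then have "pos C' t = w"
        by (auto simp: C'_def mobile_on_def)
      then show ?thesis
        using t mobH[OF True] by auto
    next
      case False
      then have vD: "v \<in> D"
        using f by (auto simp: fires_def D_def)
      then have vA: "v \<in> A"
        using f fireD by simp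
      then have "w \<in> g v ` {t \<in> ?T. pos C t = v}"
        using g[of v] w unA[OF vA] by (auto simp: bij_betw_def)
      then obtain t where t: "t \<in> ?T" "pos C t = v" "w = g v t"
        by auto
      then have "w = pos C' t"
        using vA by (auto simp: C'_def)
      moreover have "t \<in> mobile_on k ?M C v"
        using t mobD[OF vD] vA A_F F_level[OF z] by auto
      ultimately show ?thesis
        by blast
    qed
  next
    show "protected C' = protected C \<union> pos C' ` {..<?M}"
      using img imgD by (auto simp: split image_Un protC protS' C'_def)
  qed
  moreover have "follows N C' S' z'"
    unfolding follows_def
  proof (intro conjI allI impI ballI)
    show "z' \<in> Z"
      by (fact z')
    show "R z' \<subseteq> protected S'"
      using Rz' Rz protS' by (fastforce simp: A_def split: if_splits)
    have posS': "pos S' t \<in> verts H" if "t < N" for t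
      using stH[OF that] posH[OF that] by (auto simp: unprotected_nbrs_def)
    then show "protected S' \<subseteq> verts H"
      using protS protS' by auto
    show "protected C' = protected S' \<union> P z'"
      by (simp add: C'_def)
    fix t
    show "pos C' t = pos S' t" "moves C' t = moves S' t" "pos S' t \<in> verts H" if "t < N"
      using that posS' by (simp_all add: C'_def)
    show "pos C' t \<in> D" if t: "t \<in> ?T"
      using t posD[OF t] g_new[OF t] by (auto simp: C'_def new_def)
    show "moves C' t = level (pos C' t)" if t: "t \<in> ?T"
      using t posD[OF t] g_new[OF t] new_level[OF z, of "pos C t"] A_F by (auto simp: C'_def)
  next
    fix w assume w: "w \<in> D"
    have eq: "{t \<in> ?T. pos C' t = w} =
        {t \<in> ?T. pos C t \<in> A \<and> g (pos C t) t = w} \<union> {t \<in> ?T. pos C t \<notin> A \<and> pos C t = w}"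
      by (auto simp: C'_def)
    show "card {t \<in> ?T. pos C' t = w} = c z' w"
    proof (cases "w \<in> P z")
      case True
      then have "{t \<in> ?T. pos C t \<in> A \<and> g (pos C t) t = w} = {}"
        using g_new by (auto simp: new_def)
      then have "{t \<in> ?T. pos C' t = w} = (if w \<in> A then {} else {t \<in> ?T. pos C t = w})"
        using eq by auto
      then show ?thesis
        using True cz'[OF w] cnt[OF w] by auto
    next
      case False
      then have "{t \<in> ?T. pos C' t = w} = {t \<in> ?T. pos C t \<in> A \<and> g (pos C t) t = w}"
        using eq posD_P by auto
      then show ?thesis
        using False cz'[OF w] card_fibre_bij_union[OF g, of A w] by simp
    qed
  qed
  moreover have "z' = nx z" if "verts H \<subseteq> protected S" "F z \<noteq> {}"
  proof -
    have "A = F z"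
      using that by (auto simp: A_def old_def)
    then show ?thesis
      using that by (simp add: z'_def)
  qed
  ultimately show ?thesis
    by blast
qed

lemma follows_play:
  assumes "(stage k N H)\<^sup>*\<^sup>* S S'" and "follows N C S z"
  shows "\<exists>C' z'. (stage k (N + sum (c z0) D) G)\<^sup>*\<^sup>* C C' \<and> follows N C' S' z'"
  using assms
proof (induction rule: rtranclp_induct)
  case (step S1 S2)
  then obtain C1 z1 where "(stage k (N + sum (c z0) D) G)\<^sup>*\<^sup>* C C1" "follows N C1 S1 z1"
    by blast
  then show ?case
    using follows_step[OF step.hyps(2)] by (meson rtranclp.rtrancl_into_rtrancl)
qed blast

text \<open>Once \<open>H\<close> is protected, its state is held fixed while the new part runs on
  alone. Each step fires all of \<open>F z\<close>, and a firing vertex has an unprotected neighbour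
  in \<open>D\<close>, so the unprotected part of \<open>D\<close> shrinks until
  \<open>finished\<close> applies.\<close>

lemma follows_finish:
  assumes "follows N C S z" and "verts H \<subseteq> protected S"
  shows "\<exists>C'. (stage k (N + sum (c z0) D) G)\<^sup>*\<^sup>* C C' \<and> verts G \<subseteq> protected C'"
  using assms(1)
proof (induction "card (D - P z)" arbitrary: C z rule: less_induct)
  case less
  have z: "z \<in> Z" and protC: "protected C = protected S \<union> P z"
    using less.prems unfolding follows_def by auto
  show ?case
  proof (cases "F z = {}")
    case True
    then have "verts G \<subseteq> protected C"
      using finished[OF z True] assms(2) protC by (auto simp: D_def)
    then show ?thesis
      by blast
  next
    case False
    \<comment> \<open>Nothing fires in a protected \<open>H\<close>, so remaining in
      \<open>S\<close> is a legal stage, and \<open>follows_step\<close> can lift it.\<close>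
    have "pos S t \<in> protected S" if "t < N" for t
      using less.prems that assms(2) unfolding follows_def by auto
    moreover have "\<not> fires k N H S v" for v
      using assms(2) by (auto simp: fires_def unprotected_nbrs_def)
    ultimately have "stage k N H S S"
      by (auto simp: stage_def)
    from follows_step[OF this less.prems] obtain C' where
      C': "stage k (N + sum (c z0) D) G C C'" "follows N C' S (nx z)"
      using False assms(2) by blast
    obtain v where v: "v \<in> F z"
      using False by blast
    then obtain w where w: "w \<in> new z v"
      using F_new[OF z v] by blast
    have "D - P (nx z) \<subset> D - P z"
      using nx_P[OF z False] v w by (auto simp: new_def)
    then have "card (D - P (nx z)) < card (D - P z)"
      using finite_D by (intro psubset_card_mono) auto
    then show ?thesis
      using less.hyps[OF _ C'(2)] C'(1) by (meson converse_rtranclp_into_rtranclp)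
  qed
qed

text \<open>An optimal layout of \<open>H\<close>, numbered first, is combined with
  \<open>c z0 v\<close> searchers on each \<open>v\<close> of \<open>D\<close>. A winning play on
  \<open>H\<close> is lifted by \<open>follows_play\<close>, and \<open>follows_finish\<close>
  completes whatever is left of the sweep of \<open>D\<close>.\<close>

lemma deduction_number_extension:
  "deduction_number k G \<le> deduction_number k H + sum (c z0) D"
proof -
  let ?N = "deduction_number k H"
  obtain L where L: "successful k ?N H L"
    using deduction_number_attained[of H k] finite_subset[OF sub finite_verts] by blast
  then obtain S where S: "(stage k ?N H)\<^sup>*\<^sup>* (initial_state ?N L) S" "verts H \<subseteq> protected S"
    and lay: "\<And>t. t < ?N \<Longrightarrow> L t \<in> verts H"
    by (auto simp: successful_def is_layout_def)
  obtain f where f: "\<And>t. t < sum (c z0) D \<Longrightarrow> f t \<in> D"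
    and fc: "\<And>v. v \<in> D \<Longrightarrow> card {t. t < sum (c z0) D \<and> f t = v} = c z0 v"
    using ex_fun_with_fibre_cards[OF finite_D, of "c z0"] by blast
  let ?M = "?N + sum (c z0) D"
  define L' where "L' = (\<lambda>t. if t < ?N then L t else f (t - ?N))"
  have cnt: "card {t \<in> {?N..<?M}. L' t = v} = c z0 v" if v: "v \<in> D" for v
  proof -
    have "bij_betw (\<lambda>t. t - ?N) {t \<in> {?N..<?M}. L' t = v} {t. t < sum (c z0) D \<and> f t = v}"
      by (rule bij_betw_byWitness[where f' = "\<lambda>t. t + ?N"]) (auto simp: L'_def)
    then show ?thesis
      using fc[OF v] by (simp add: bij_betw_same_card)
  qed
  have L'D: "L' t \<in> D" if "t \<in> {?N..<?M}" for t
    using that f[of "t - ?N"] by (auto simp: L'_def)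
  have occ: "0 < c z0 (L' t)" if "t \<in> {?N..<?M}" for t
  proof -
    have "0 < card {t' \<in> {?N..<?M}. L' t' = L' t}"
      using that by (subst card_gt_0_iff) auto
    then show ?thesis
      using cnt[OF L'D[OF that]] by simp
  qed
  have split: "{..<?M} = {..<?N} \<union> {?N..<?M}"
    by auto
  have "L' ` {?N..<?M} = P z0"
  proof
    show "L' ` {?N..<?M} \<subseteq> P z0"
      using occ L'D by (auto simp: start)
    show "P z0 \<subseteq> L' ` {?N..<?M}"
    proof
      fix v assume "v \<in> P z0"
      then have "0 < card {t \<in> {?N..<?M}. L' t = v}"
        using cnt by (auto simp: start)
      then show "v \<in> L' ` {?N..<?M}"
        by (auto simp: card_gt_0_iff)
    qed
  qed
  moreover have "L' ` {..<?N} = L ` {..<?N}"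
    by (auto simp: L'_def)
  ultimately have "follows ?N (initial_state ?M L') (initial_state ?N L) z0"
    using cnt L'D occ lay start unfolding follows_def
    by (auto simp: initial_state_def split image_Un) (auto simp: L'_def)
  then obtain C z where C: "(stage k ?M G)\<^sup>*\<^sup>* (initial_state ?M L') C" "follows ?N C S z"
    using follows_play[OF S(1)] by blast
  then obtain C' where "(stage k ?M G)\<^sup>*\<^sup>* C C'" "verts G \<subseteq> protected C'"
    using follows_finish[OF C(2) S(2)] by blast
  moreover have "is_layout ?M G L'"
  proof -
    have "L' t \<in> verts G" if "t < ?M" for t
      using that L'D[of t] lay[of t] sub by (cases "t < ?N") (auto simp: L'_def D_def)
    then show ?thesis
      by (simp add: is_layout_def)
  qed
  ultimately have "successful k ?M G L'"
    using C(1) unfolding successful_def by (meson rtranclp_trans)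
  then show ?thesis
    by (rule deduction_number_le)
qed

end

section \<open>Invariance under relabelling vertices\<close>

text \<open>\<open>h\<close> relabels a whole game state, and every stage on \<open>G\<close>
  becomes a stage on \<open>G'\<close>. Because \<open>f\<close> is a bijection of the whole vertex
  type, firing and mobility correspond at every vertex without side conditions.\<close>

lemma deduction_number_iso_le:
  assumes f: "bij f" and V: "verts G' = f ` verts G"
    and adj: "\<And>v w. adj G' (f v) (f w) = adj G v w" and fin: "finite (verts G)"
  shows "deduction_number k G' \<le> deduction_number k G"
proof -
  let ?N = "deduction_number k G"
  define h where "h S = \<lparr>pos = f \<circ> pos S, moves = moves S, protected = f ` protected S\<rparr>"
    for S :: "'a game_state"
  have inj: "f x = f y \<longleftrightarrow> x = y" for x y
    using f by (auto simp: bij_def inj_eq)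
  have surj: "\<exists>v. w = f v" for w
    using f by (metis bij_pointE)
  have un: "unprotected_nbrs G' (h S) (f v) = f ` unprotected_nbrs G S v" for S v
    using V adj by (auto simp: unprotected_nbrs_def h_def inj)
  have mob: "mobile_on k ?N (h S) (f v) = mobile_on k ?N S v" for S v
    by (auto simp: mobile_on_def h_def inj)
  have card: "card (f ` X) = card X" for X
    using f by (auto simp: bij_def intro!: card_image inj_on_subset[of f UNIV])
  have fire: "fires k ?N G' (h S) (f v) = fires k ?N G S v" for S v
    unfolding fires_def un mob card using V by (auto simp: inj)
  have stage: "stage k ?N G' (h S) (h S')" if "stage k ?N G S S'" for S S'
    unfolding stage_def
  proof (intro conjI allI impI ballI)
    fix i assume i: "i < ?N"
    have p: "pos (h S) i = f (pos S i)"
      by (simp add: h_def)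
    show "(pos (h S') i = pos (h S) i \<and> moves (h S') i = moves (h S) i) \<or>
      (fires k ?N G' (h S) (pos (h S) i) \<and> i \<in> mobile_on k ?N (h S) (pos (h S) i) \<and>
       pos (h S') i \<in> unprotected_nbrs G' (h S) (pos (h S) i) \<and> moves (h S') i = Suc (moves (h S) i))"
      unfolding p un mob fire using that i by (auto simp: stage_def h_def)
  next
    fix v w assume fr: "fires k ?N G' (h S) v" and w: "w \<in> unprotected_nbrs G' (h S) v"
    obtain v' where v': "v = f v'"
      using surj by blast
    then obtain w' where "w = f w'" "w' \<in> unprotected_nbrs G S v'"
      using w un by auto
    moreover from this have "\<exists>i\<in>mobile_on k ?N S v'. pos S' i = w'"
      using that fr unfolding v' fire stage_def by blast
    ultimately show "\<exists>i\<in>mobile_on k ?N (h S) v. pos (h S') i = w"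
      unfolding v' mob by (auto simp: h_def)
  next
    have "protected S' = protected S \<union> pos S' ` {..<?N}"
      using that by (simp add: stage_def)
    then show "protected (h S') = protected (h S) \<union> pos (h S') ` {..<?N}"
      by (simp add: h_def image_Un image_comp)
  qed
  obtain L where L: "successful k ?N G L"
    using deduction_number_attained[OF fin] by blast
  then obtain S where S: "(stage k ?N G)\<^sup>*\<^sup>* (initial_state ?N L) S" "verts G \<subseteq> protected S"
    by (auto simp: successful_def)
  from S(1) have "(stage k ?N G')\<^sup>*\<^sup>* (h (initial_state ?N L)) (h S)"
    by (induction rule: rtranclp_induct) (auto intro: rtranclp.rtrancl_into_rtrancl stage)
  moreover have "h (initial_state ?N L) = initial_state ?N (f \<circ> L)"
    by (simp add: h_def initial_state_def image_comp)
  moreover have "verts G' \<subseteq> protected (h S)"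
    using S(2) V by (auto simp: h_def)
  moreover have "is_layout ?N G' (f \<circ> L)"
    using L V by (auto simp: successful_def is_layout_def)
  ultimately have "successful k ?N G' (f \<circ> L)"
    by (auto simp: successful_def)
  then show ?thesis
    by (rule deduction_number_le)
qed

lemma deduction_number_grid_swap:
  "deduction_number k (path_graph a \<boxtimes> path_graph b) \<le> deduction_number k (path_graph b \<boxtimes> path_graph a)"
proof (rule deduction_number_iso_le[of prod.swap])
  show "adj (path_graph a \<boxtimes> path_graph b) (prod.swap v) (prod.swap w) =
    adj (path_graph b \<boxtimes> path_graph a) v w" for v w
    by (cases v; cases w) (auto simp: adj_strong_grid)
qed (auto simp: bij_swap image_iff)

section \<open>Appending a block of columns to a grid\<close>

text \<open>King-move adjacency including equality, written with \<open>Suc\<close> to avoid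
  truncated subtraction. Equality does no harm below: \<open>reach\<close> is applied to protected
  vertices and removes them, and \<open>before\<close> to vertices outside the old columns.\<close>

definition near :: "nat \<times> nat \<Rightarrow> nat \<times> nat \<Rightarrow> bool" where
  "near v w \<longleftrightarrow> fst v \<le> Suc (fst w) \<and> fst w \<le> Suc (fst v) \<and>
     snd v \<le> Suc (snd w) \<and> snd w \<le> Suc (snd v)"

text \<open>Here \<open>l\<close> is the number of moves needed to cross the block, which therefore
  has \<open>l + 1\<close> columns.\<close>

definition block :: "nat \<Rightarrow> nat \<Rightarrow> nat \<Rightarrow> (nat \<times> nat) set" where
  "block a b l = {..<a} \<times> {b..b + l}"

definition before :: "nat \<Rightarrow> nat \<Rightarrow> nat \<times> nat \<Rightarrow> (nat \<times> nat) set" where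
  "before a b v = {w \<in> {..<a} \<times> {..<b}. near v w}"

definition reach :: "(nat \<times> nat) set \<Rightarrow> (nat \<times> nat) set \<Rightarrow> nat \<times> nat \<Rightarrow> (nat \<times> nat) set" where
  "reach B X v = {w \<in> B. near v w \<and> w \<notin> X}"

text \<open>The grid form of \<open>block_extension\<close>, with \<open>before\<close> and
  \<open>reach\<close> in the roles of \<open>old\<close> and \<open>new\<close>. Every move goes
  one column to the right, so the number of moves made can be read off as
  \<open>snd v - b\<close>.\<close>

locale grid_block =
  fixes k a b l :: nat and Z :: "'z set" and z0 :: 'z
    and P :: "'z \<Rightarrow> (nat \<times> nat) set" and c :: "'z \<Rightarrow> nat \<times> nat \<Rightarrow> nat"
    and F R :: "'z \<Rightarrow> (nat \<times> nat) set" and nx :: "'z \<Rightarrow> 'z"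
  assumes start: "z0 \<in> Z" "R z0 = {}" "P z0 = {v \<in> (block a b l). 0 < c z0 v}"
      "\<And>v. v \<in> (block a b l) \<Longrightarrow> 0 < c z0 v \<Longrightarrow> snd v = b"
    and first_column: "\<And>z. z \<in> Z \<Longrightarrow> {..<a} \<times> {b} \<subseteq> P z"
    and P_sub: "\<And>z. z \<in> Z \<Longrightarrow> P z \<subseteq> (block a b l)"
    and occupied: "\<And>z v. z \<in> Z \<Longrightarrow> v \<in> (block a b l) \<Longrightarrow> 0 < c z v \<Longrightarrow> v \<in> P z"
    and F_sub: "\<And>z. z \<in> Z \<Longrightarrow> F z \<subseteq> (block a b l)"
    and F_column: "\<And>z v. z \<in> Z \<Longrightarrow> v \<in> F z \<Longrightarrow> snd v < b + k"
    and F_reach: "\<And>z v. z \<in> Z \<Longrightarrow> v \<in> F z \<Longrightarrow> reach (block a b l) (P z) v \<noteq> {}"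
    and F_card: "\<And>z v. z \<in> Z \<Longrightarrow> v \<in> F z \<Longrightarrow> card (reach (block a b l) (P z) v) = c z v"
    and reach_column: "\<And>z v w. z \<in> Z \<Longrightarrow> v \<in> F z \<Longrightarrow> w \<in> reach (block a b l) (P z) v \<Longrightarrow> snd w = Suc (snd v)"
    and gate: "\<And>z v v'. z \<in> Z \<Longrightarrow> v \<in> F z \<Longrightarrow> v' \<in> F z \<Longrightarrow> before a b v \<subseteq> R z \<union> before a b v'"
    and idle: "\<And>z v. z \<in> Z \<Longrightarrow> v \<in> (block a b l) \<Longrightarrow> v \<notin> F z \<Longrightarrow> 0 < c z v \<Longrightarrow>
      b + k \<le> snd v \<or> c z v < card (reach (block a b l) (P z) v) \<or> (reach (block a b l) (P z) v = {} \<and> before a b v = {})"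
    and nx_in: "\<And>z. z \<in> Z \<Longrightarrow> F z \<noteq> {} \<Longrightarrow> nx z \<in> Z"
    and nx_R: "\<And>z. z \<in> Z \<Longrightarrow> F z \<noteq> {} \<Longrightarrow> R (nx z) \<subseteq> R z \<union> (\<Union>v\<in>F z. before a b v)"
    and nx_P: "\<And>z. z \<in> Z \<Longrightarrow> F z \<noteq> {} \<Longrightarrow> P (nx z) = P z \<union> (\<Union>v\<in>F z. reach (block a b l) (P z) v)"
    and nx_c: "\<And>z w. z \<in> Z \<Longrightarrow> F z \<noteq> {} \<Longrightarrow> w \<in> (block a b l) \<Longrightarrow> c (nx z) w =
      (if w \<in> P z then (if w \<in> F z then 0 else c z w) else card {v \<in> F z. w \<in> reach (block a b l) (P z) v})"
    and finished: "\<And>z. z \<in> Z \<Longrightarrow> F z = {} \<Longrightarrow> P z = (block a b l)"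
begin

lemma extension:
  "deduction_number k (path_graph a \<boxtimes> path_graph (b + Suc l))
    \<le> deduction_number k (path_graph a \<boxtimes> path_graph b) + sum (c z0) (block a b l)"
proof -
  note add_Suc_right [simp del]
  let ?B = "block a b l" and ?G = "path_graph a \<boxtimes> path_graph (b + Suc l)" and ?H = "path_graph a \<boxtimes> path_graph b"
  have B: "verts ?G - verts ?H = ?B"
    by (auto simp: block_def)
  have adjG: "adj ?G v w \<longleftrightarrow> v \<in> verts ?G \<and> w \<in> verts ?G \<and> v \<noteq> w \<and> near v w"
    and adjH: "adj ?H v w \<longleftrightarrow> v \<in> verts ?H \<and> w \<in> verts ?H \<and> v \<noteq> w \<and> near v w" for v w
    by (cases v; cases w; auto simp: adj_strong_grid near_def)+
  have BG: "?B \<subseteq> verts ?G"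
    by (auto simp: block_def)
  have old: "{w \<in> verts ?H. adj ?G v w} = before a b v" if "v \<in> ?B" for v
    using that by (auto simp: adjG before_def block_def)
  have new: "{w \<in> ?B. adj ?G v w \<and> w \<notin> P z} = reach ?B (P z) v" if "z \<in> Z" "v \<in> P z" for z v
    using that P_sub[of z] BG by (auto simp: adjG reach_def)
  \<comment> \<open>A firing vertex has at least one vertex to reach, hence a positive searcher
    count, hence is protected.\<close>
  have F_P: "v \<in> P z" if "z \<in> Z" "v \<in> F z" for z v
  proof -
    have "finite (reach ?B (P z) v)"
      by (simp add: reach_def block_def)
    then have "0 < c z v"
      using F_card[OF that] F_reach[OF that] by (metis card_gt_0_iff)
    then show ?thesis
      using occupied F_sub that by blast
  qed
  have newF: "{w \<in> ?B. adj ?G v w \<and> w \<notin> P z} = reach ?B (P z) v" if "z \<in> Z" "v \<in> F z" for z v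
    using new F_P that by blast
  have oldF: "{w \<in> verts ?H. adj ?G v w} = before a b v" if "z \<in> Z" "v \<in> F z" for z v
    using old F_sub that by blast
  have "block_extension k ?H ?G Z z0 P c F R nx (\<lambda>v. snd v - b)"
  proof (unfold_locales, unfold B)
    show "finite (verts ?G)" "verts ?H \<subseteq> verts ?G"
      by auto
    show "adj ?H v w = adj ?G v w" if "v \<in> verts ?H" "w \<in> verts ?H" for v w
      using that by (auto simp: adjG adjH)
    show "w \<in> P z" if "z \<in> Z" "v \<in> verts ?H" "w \<in> ?B" "adj ?G v w" for z v w
    proof -
      \<comment> \<open>An edge from the old columns can enter the block only in column
        \<open>b\<close>, which is protected from the start.\<close>
      have "w \<in> {..<a} \<times> {b}"
        using that(2-4) unfolding adjG by (auto simp: near_def block_def)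
      then show ?thesis
        using first_column[OF that(1)] by blast
    qed
    show "snd v - b < k" if "z \<in> Z" "v \<in> F z" for z v
      using F_column[OF that] subsetD[OF P_sub F_P, OF that(1) that] by (cases v) (auto simp: block_def)
    show "snd w - b = Suc (snd v - b)"
      if "z \<in> Z" "v \<in> F z" "w \<in> {w \<in> ?B. adj ?G v w \<and> w \<notin> P z}" for z v w
    proof -
      have "w \<in> reach ?B (P z) v"
        using that(3) unfolding newF[OF that(1,2)] .
      then show ?thesis
        using reach_column[OF that(1,2)] subsetD[OF F_sub that(2), OF that(1)]
        by (cases v) (auto simp: block_def)
    qed
    show "k \<le> snd v - b \<or> c z v < card {w \<in> ?B. adj ?G v w \<and> w \<notin> P z} \<or> c z v = 0 \<or>
        {w \<in> ?B. adj ?G v w \<and> w \<notin> P z} = {} \<and> {w \<in> verts ?H. adj ?G v w} = {}"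
      if "z \<in> Z" "v \<in> ?B" "v \<notin> F z" for z v
    proof (cases "c z v = 0")
      case False
      then have "v \<in> P z"
        using occupied that by simp
      then show ?thesis
        unfolding old[OF that(2)] new[OF that(1) \<open>v \<in> P z\<close>]
        using idle[OF that] False by auto
    qed simp
    show "c (nx z) w = (if w \<in> P z then if w \<in> F z then 0 else c z w
        else card {v \<in> F z. w \<in> {w \<in> ?B. adj ?G v w \<and> w \<notin> P z}})"
      if "z \<in> Z" "F z \<noteq> {}" "w \<in> ?B" for z w
    proof -
      have "{v \<in> F z. w \<in> {w \<in> ?B. adj ?G v w \<and> w \<notin> P z}} = {v \<in> F z. w \<in> reach ?B (P z) v}"
        using newF[OF that(1)] by blast
      then show ?thesis
        using nx_c[OF that] by (simp only:)
    qed
    show "R (nx z) \<subseteq> R z \<union> (\<Union>v\<in>F z. {w \<in> verts ?H. adj ?G v w})"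
      if "z \<in> Z" "F z \<noteq> {}" for z
      using nx_R[OF that] oldF[OF that(1)] by (simp cong: SUP_cong)
    show "P (nx z) = P z \<union> (\<Union>v\<in>F z. {w \<in> ?B. adj ?G v w \<and> w \<notin> P z})"
      if "z \<in> Z" "F z \<noteq> {}" for z
      using nx_P[OF that] newF[OF that(1)] by (simp only: cong: SUP_cong)
    show "{w \<in> verts ?H. adj ?G v w} \<subseteq> R z \<union> {w \<in> verts ?H. adj ?G v' w}"
      if "z \<in> Z" "v \<in> F z" "v' \<in> F z" for z v v'
      using gate[OF that] unfolding oldF[OF that(1,2)] oldF[OF that(1,3)] .
    show "{w \<in> ?B. adj ?G v w \<and> w \<notin> P z} \<noteq> {}" "card {w \<in> ?B. adj ?G v w \<and> w \<notin> P z} = c z v"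
      if "z \<in> Z" "v \<in> F z" for z v
      unfolding newF[OF that] by (fact F_reach[OF that], fact F_card[OF that])
  qed (use start P_sub occupied F_sub nx_in finished in \<open>auto\<close>)
  then show ?thesis
    by (metis block_extension.deduction_number_extension B)
qed

end

section \<open>Sweeps of one, two, and at least three rows\<close>

text \<open>A single searcher walks along the new part; state \<open>j\<close> is the number of its
  moves. At the end it may still be mobile, so it must not be adjacent to the old part, which
  \<open>0 < l \<or> b = 0\<close> ensures. Allowing \<open>l < k\<close> covers a shorter remainder
  path as well as full blocks.\<close>

lemma path_extension:
  assumes "l \<le> k" and "0 < l \<or> b = 0"
  shows "deduction_number k (path_graph 1 \<boxtimes> path_graph (b + Suc l))
    \<le> deduction_number k (path_graph 1 \<boxtimes> path_graph b) + 1"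
proof -
  let ?P = "\<lambda>j. {0} \<times> {b..b + j}"
  have reach: "reach (block 1 b l) (?P j) (0, b + j) = (if j < l then {(0, b + Suc j)} else {})" for j
    by (auto simp: reach_def block_def near_def)
  have block: "block 1 b l = {0} \<times> {b..b + l}"
    by (auto simp: block_def)
  have before: "before 1 0 v = {}" "0 < l \<Longrightarrow> before 1 b (0, b + l) = {}" for v
    using assms by (auto simp: before_def near_def)
  interpret grid_block k 1 b l "{..l}" 0 ?P "\<lambda>j v. if v = (0, b + j) then 1 else 0"
    "\<lambda>j. if j < l then {(0, b + j)} else {}" "\<lambda>_. {}" Suc
  proof unfold_locales
    fix j w
    assume j: "j \<in> {..l}" "(if j < l then {(0, b + j)} else {}) \<noteq> {}" and w: "w \<in> block 1 b l"
    then have "{v \<in> if j < l then {(0, b + j)} else {}. w \<in> reach (block 1 b l) (?P j) v} =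
        (if w = (0, b + Suc j) then {(0, b + j)} else {})"
      by (auto simp: reach simp del: One_nat_def)
    then show "(if w = (0, b + Suc j) then 1 else 0) = (if w \<in> ?P j
        then if w \<in> (if j < l then {(0, b + j)} else {}) then 0 else if w = (0, b + j) then 1 else 0
        else card {v \<in> if j < l then {(0, b + j)} else {}. w \<in> reach (block 1 b l) (?P j) v})"
      using j w by auto
  qed (use assms before in \<open>auto simp: reach[unfolded block] block simp del: One_nat_def split: if_splits\<close>)
  show ?thesis
    using extension unfolding block by (simp add: sum.delta)
qed

text \<open>Each of the two vertices of column \<open>b + j\<close> carries two searchers and sees
  both vertices of the next column. Both fire at once, and each target receives one searcher from
  either, which restores two pairs.\<close>

lemma two_row_extension:
  "deduction_number k (path_graph 2 \<boxtimes> path_graph (b + Suc k))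
    \<le> deduction_number k (path_graph 2 \<boxtimes> path_graph b) + 4"
proof -
  let ?P = "\<lambda>j. {..<2 :: nat} \<times> {b..b + j}"
  let ?F = "\<lambda>j. if j < k then {..<2 :: nat} \<times> {b + j} else {}"
  have reach: "reach (block 2 b k) (?P j) v = {..<2 :: nat} \<times> {b + Suc j}" if "v \<in> ?F j" for v j
    using that by (auto simp: reach_def block_def near_def split: if_splits)
  interpret grid_block k 2 b k "{..k}" 0 ?P "\<lambda>j v. if snd v = b + j then 2 else 0"
    ?F "\<lambda>_. {}" Suc
  proof unfold_locales
    fix j w
    assume j: "j \<in> {..k}" "?F j \<noteq> {}" and w: "w \<in> block 2 b k"
    have "{v \<in> ?F j. w \<in> reach (block 2 b k) (?P j) v} =
        (if snd w = b + Suc j then {..<2 :: nat} \<times> {b + j} else {})"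
      using j w reach[of _ j] by (auto simp: block_def split: if_splits)
    then show "(if snd w = b + Suc j then 2 else 0) = (if w \<in> ?P j
        then if w \<in> ?F j then 0 else if snd w = b + j then 2 else 0
        else card {v \<in> ?F j. w \<in> reach (block 2 b k) (?P j) v})"
      using j w by (auto simp: card_cartesian_product)
  next
    \<comment> \<open>With only two rows, both vertices of a column have the same neighbours in the
      old part, so an empty \<open>R\<close> suffices.\<close>
    show "before 2 b v \<subseteq> {} \<union> before 2 b v'" if "v \<in> ?F j" "v' \<in> ?F j" for v v' j
      using that by (auto simp: before_def near_def split: if_splits)
    show "reach (block 2 b k) (?P j) v \<noteq> {}" "card (reach (block 2 b k) (?P j) v) = (if snd v = b + j then 2 else 0)"
      if "v \<in> ?F j" for v j
      using that by (simp_all only: reach) (auto simp: card_cartesian_product split: if_splits)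
    show "snd w = Suc (snd v)" if "v \<in> ?F j" "w \<in> reach (block 2 b k) (?P j) v" for v w j
      using that(2) unfolding reach[OF that(1)] using that(1) by (auto split: if_splits)
    show "?P (Suc j) = ?P j \<union> (\<Union>v\<in>?F j. reach (block 2 b k) (?P j) v)" if "?F j \<noteq> {}" for j
    proof -
      have "(\<Union>v\<in>?F j. reach (block 2 b k) (?P j) v) = (\<Union>v\<in>?F j. {..<2 :: nat} \<times> {b + Suc j})"
        by (intro SUP_cong refl reach)
      also have "\<dots> = {..<2 :: nat} \<times> {b + Suc j}"
        using that by (simp only: UN_constant if_False)
      finally have U: "(\<Union>v\<in>?F j. reach (block 2 b k) (?P j) v) = {..<2 :: nat} \<times> {b + Suc j}" .
      show ?thesis
        unfolding U by auto
    qed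
  qed (auto simp: block_def split: if_splits)
  have "(\<Sum>v\<in>block 2 b k. if snd v = b + 0 then 2 else 0) = (\<Sum>v\<in>{..<2 :: nat} \<times> {b}. (2 :: nat))"
    by (rule sum.mono_neutral_cong_right) (auto simp: block_def)
  then show ?thesis
    using extension by (simp add: card_cartesian_product)
qed
lemma one_less_cardI:
  assumes "finite A" "p \<in> A" "q \<in> A" "p \<noteq> q"
  shows "1 < card A"
  using card_mono[OF assms(1), of "{p, q}"] assms by simp

text \<open>
  In state \<open>(j, i)\<close> the block columns up to \<open>j\<close> are protected and \<open>i\<close> vertices of column \<open>j\<close> have
  fired. Rows are counted from the corner holding the pair, which alternates; hence \<open>\<rho> j\<close>.
\<close>

lemma zigzag_extension:
  assumes a: "3 \<le> a" and k: "0 < k"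
  shows "deduction_number k (path_graph a \<boxtimes> path_graph (b + Suc k))
    \<le> deduction_number k (path_graph a \<boxtimes> path_graph b) + (a + 1)"
proof -
  define \<rho> where "\<rho> j x = (if even j then x else a - 1 - x)" for j x :: nat
  \<comment> \<open>The index \<open>i\<close> stops at \<open>a - 2\<close> because rows
    \<open>a - 2\<close> and \<open>a - 1\<close> fire together; the next state is then
    \<open>(Suc j, 0)\<close>, and \<open>(k, 0)\<close> is final.\<close>
  define Z where "Z = {(j, i). (j < k \<and> i \<le> a - 2) \<or> (j = k \<and> i = 0)}"
  define P where "P = (\<lambda>(j, i). {(x, y). x < a \<and> b \<le> y \<and>
    (y \<le> b + j \<or> (y = b + Suc j \<and> 0 < i \<and> \<rho> j x \<le> i))})"
  \<comment> \<open>At \<open>i = 0\<close> row 0 holds the pair and all other rows one searcher.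
    Later, the rows that have not fired keep one searcher each, and the rows up to \<open>i\<close>
    of the next column have received one each.\<close>
  define c where "c = (\<lambda>(j, i) (x, y). if y = b + j
    then (if i = 0 then (if \<rho> j x = 0 then 2 else 1) else if i \<le> \<rho> j x then 1 else 0)
    else if y = b + Suc j \<and> 0 < i \<and> \<rho> j x \<le> i then 1 else (0 :: nat))"
  define F where "F = (\<lambda>(j, i). {(x, y). y = b + j \<and> x < a \<and> j < k \<and>
    (\<rho> j x = i \<or> (i = a - 2 \<and> \<rho> j x = a - 1))})"
  \<comment> \<open>Rows below \<open>i\<close> of column \<open>b\<close> have fired, so rows up to
    \<open>i\<close> of column \<open>b - 1\<close> were already protected. This is needed for the
    final simultaneous firing in column \<open>b\<close>: row \<open>a - 2\<close> has the old
    neighbour in row \<open>a - 3\<close>, which row \<open>a - 1\<close> does not have.\<close>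
  define R where "R = (\<lambda>(j :: nat, i). {(x, y). x < a \<and> Suc y = b \<and> j = 0 \<and> 0 < i \<and> x \<le> i})"
  define nx where "nx = (\<lambda>(j, i). if i = a - 2 then (Suc j, 0) else (j, Suc i))"
  have \<rho>_less: "\<rho> j x < a" if "x < a" for j x
    using that by (auto simp: \<rho>_def)
  have \<rho>_\<rho>: "\<rho> j (\<rho> j x) = x" if "x < a" for j x
    using that by (auto simp: \<rho>_def)
  have \<rho>_iff: "x < a \<and> \<rho> j x = t \<longleftrightarrow> x = \<rho> j t" if "t < a" for x t j
    using that by (auto simp: \<rho>_def)
  have \<rho>_0: "\<rho> 0 x = x" for x
    by (simp add: \<rho>_def)
  have \<rho>_Suc: "\<rho> (Suc j) x = a - 1 - \<rho> j x" if "x < a" for j x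
    using that by (auto simp: \<rho>_def)
  have near_\<rho>: "near (x, y) (x', y') \<longleftrightarrow> near (\<rho> j x, y) (\<rho> j x', y')" if "x < a" "x' < a" for j x x' y y'
    using that by (auto simp: \<rho>_def near_def)
  have P_iff: "(x, y) \<in> P (j, i) \<longleftrightarrow> x < a \<and> b \<le> y \<and>
      (y \<le> b + j \<or> (y = b + Suc j \<and> 0 < i \<and> \<rho> j x \<le> i))" for x y j i
    by (simp add: P_def)
  have F_iff: "(x, y) \<in> F (j, i) \<longleftrightarrow> y = b + j \<and> x < a \<and> j < k \<and>
      (\<rho> j x = i \<or> (i = a - 2 \<and> \<rho> j x = a - 1))" for x y j i
    by (simp add: F_def)
  have block_iff: "(x, y) \<in> block a b k \<longleftrightarrow> x < a \<and> b \<le> y \<and> y \<le> b + k" for x y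
    by (simp add: block_def)
  have c_eq: "c (j, i) (x, y) = (if y = b + j
    then (if i = 0 then (if \<rho> j x = 0 then 2 else 1) else if i \<le> \<rho> j x then 1 else 0)
    else if y = b + Suc j \<and> 0 < i \<and> \<rho> j x \<le> i then 1 else (0 :: nat))" for j i x y
    by (simp add: c_def)
  have Z_iff: "(j, i) \<in> Z \<longleftrightarrow> (j < k \<and> i \<le> a - 2) \<or> (j = k \<and> i = 0)" for j i
    by (simp add: Z_def)
  have reach_iff: "(x', y') \<in> reach (block a b k) (P (j, i)) (x, y) \<longleftrightarrow>
      x' < a \<and> b \<le> y' \<and> y' \<le> b + k \<and> near (\<rho> j x, y) (\<rho> j x', y') \<and>
      \<not> (y' \<le> b + j \<or> (y' = b + Suc j \<and> 0 < i \<and> \<rho> j x' \<le> i))"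
    if "x < a" for x y x' y' j i
    using that near_\<rho>[of x x' y y' j] by (auto simp: reach_def block_iff P_iff)
  have reach_F: "reach (block a b k) (P (j, i)) (x, b + j) =
      (if i = 0 then {(\<rho> j 0, b + Suc j), (\<rho> j 1, b + Suc j)} else {(\<rho> j (Suc i), b + Suc j)})"
    if z: "(j, i) \<in> Z" and v: "(x, b + j) \<in> F (j, i)" for j i x
  proof -
    have x: "x < a" "j < k" "i \<le> a - 2" and "\<rho> j x = i \<or> (i = a - 2 \<and> \<rho> j x = a - 1)"
      using z v by (auto simp: Z_iff F_iff)
    then have A: "(x', y') \<in> reach (block a b k) (P (j, i)) (x, b + j) \<longleftrightarrow>
      x' < a \<and> y' = b + Suc j \<and> (if i = 0 then \<rho> j x' = 0 \<or> \<rho> j x' = 1 else \<rho> j x' = Suc i)" for x' y'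
      using a \<rho>_less[of x' j] by (auto simp: reach_iff near_def)
    have lt: "0 < a" "1 < a" "Suc i < a"
      using a x(3) by auto
    have B: "x' < a \<and> y' = b + Suc j \<and> (if i = 0 then \<rho> j x' = 0 \<or> \<rho> j x' = 1 else \<rho> j x' = Suc i)
      \<longleftrightarrow> (x', y') \<in> (if i = 0 then {(\<rho> j 0, b + Suc j), (\<rho> j 1, b + Suc j)}
        else {(\<rho> j (Suc i), b + Suc j)})" for x' y'
      using \<rho>_iff[OF lt(1), of x' j] \<rho>_iff[OF lt(2), of x' j] \<rho>_iff[OF lt(3), of x' j] by auto
    show ?thesis
      by (simp only: set_eq_iff split_paired_All A B simp_thms)
  qed
  have \<rho>_01: "\<rho> j 0 \<noteq> \<rho> j 1" for j
    using a by (auto simp: \<rho>_def)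
  have fin: "finite (reach (block a b k) X v)" for X v
    by (simp add: reach_def block_def)
  interpret grid_block k a b k Z "(0, 0)" P c F R nx
  proof unfold_locales
    show "(0, 0) \<in> Z" "R (0, 0) = {}" "P (0, 0) = {v \<in> block a b k. 0 < c (0, 0) v}"
      using k by (auto simp: Z_iff R_def P_iff c_eq block_iff split: if_splits)
    show "snd v = b" if "v \<in> block a b k" "0 < c (0, 0) v" for v
      using that by (cases v) (auto simp: c_eq split: if_splits)
    show "{..<a} \<times> {b} \<subseteq> P z" for z
      by (cases z) (auto simp: P_iff)
    show "P z \<subseteq> block a b k" if "z \<in> Z" for z
      using that by (cases z) (auto simp: P_iff Z_iff block_iff)
    show "v \<in> P z" if "v \<in> block a b k" "0 < c z v" for z v
      using that by (cases z; cases v) (auto simp: P_iff c_eq block_iff split: if_splits)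
    show "F z \<subseteq> block a b k" for z
      by (cases z) (auto simp: F_iff block_iff)
    show "snd v < b + k" if "v \<in> F z" for z v
      using that by (cases z; cases v) (auto simp: F_iff)
  next
    fix z v assume zv: "z \<in> Z" "v \<in> F z"
    obtain j i x where e: "z = (j, i)" "v = (x, b + j)"
      using zv by (cases z; cases v) (auto simp: F_iff)
    have r: "reach (block a b k) (P z) v =
      (if i = 0 then {(\<rho> j 0, b + Suc j), (\<rho> j 1, b + Suc j)} else {(\<rho> j (Suc i), b + Suc j)})"
      using zv unfolding e by (rule reach_F)
    show "reach (block a b k) (P z) v \<noteq> {}"
      unfolding r by simp
    show "card (reach (block a b k) (P z) v) = c z v"
      unfolding r using zv \<rho>_01 a by (auto simp: e c_eq F_iff)
    show "snd w = Suc (snd v)" if "w \<in> reach (block a b k) (P z) v" for w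
      using that unfolding r by (auto simp: e split: if_splits)
    show "before a b v \<subseteq> R z \<union> before a b v'" if "v' \<in> F z" for v'
    proof (cases "j = 0")
      case True
      then show ?thesis
        using zv that a by (cases v') (auto simp: e F_iff Z_iff R_def before_def near_def \<rho>_0)
    next
      case False
      then show ?thesis
        by (auto simp: e before_def near_def)
    qed
  next
    fix z v
    assume z: "z \<in> Z" and v: "v \<in> block a b k" "v \<notin> F z" "0 < c z v"
    obtain j i x y where e: "z = (j, i)" "v = (x, y)"
      by (cases z; cases v)
    have x: "x < a" "b \<le> y" "y \<le> b + k"
      using v by (auto simp: e block_iff)
    show "b + k \<le> snd v \<or> c z v < card (reach (block a b k) (P z) v) \<or>
        (reach (block a b k) (P z) v = {} \<and> before a b v = {})"
    proof (cases "b + k \<le> y")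
      case False
      then have jk: "j < k" and i: "i \<le> a - 2"
        using z v by (auto simp: e Z_iff c_eq split: if_splits)
      \<comment> \<open>The only vertex with two searchers is the pair, and it belongs to
        \<open>F z\<close> as long as \<open>j < k\<close>.\<close>
      have c1: "c z v = 1"
        using v jk x by (auto simp: e c_eq F_iff split: if_splits)
      \<comment> \<open>A lone searcher stays idle if it sees two unprotected vertices in the next
        column: one in its own row and one in an adjacent row \<open>t\<close>. That row is the
        following one, or \<open>a - 2\<close> for the last row; there \<open>i < a - 2\<close>
        holds in column \<open>b + j\<close>, since otherwise the vertex would be in
        \<open>F z\<close>.\<close>
      have "\<exists>t < a. t \<noteq> \<rho> j x \<and> near (\<rho> j x, y) (t, Suc y) \<and> (y = b + j \<longrightarrow> i < t \<or> i = 0)"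
      proof (cases "Suc (\<rho> j x) < a")
        case True
        then show ?thesis
          using v by (intro exI[of _ "Suc (\<rho> j x)"]) (auto simp: near_def e c_eq split: if_splits)
      next
        case False
        then have "\<rho> j x = a - 1"
          using \<rho>_less[OF x(1), of j] by linarith
        then show ?thesis
          using a i v x jk by (intro exI[of _ "a - 2"]) (auto simp: near_def e F_iff)
      qed
      then obtain t where t: "t < a" "t \<noteq> \<rho> j x" "near (\<rho> j x, y) (t, Suc y)"
        "y = b + j \<longrightarrow> i < t \<or> i = 0"
        by blast
      have "(\<rho> j t, Suc y) \<in> reach (block a b k) (P z) v"
        using t x False v by (auto simp: e reach_iff \<rho>_\<rho> \<rho>_less c_eq split: if_splits)
      moreover have "(x, Suc y) \<in> reach (block a b k) (P z) v"
        using x False v jk by (auto simp: e reach_iff c_eq near_def F_iff split: if_splits)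
      moreover have "\<rho> j t \<noteq> x"
        using t \<rho>_\<rho> by auto
      ultimately have "1 < card (reach (block a b k) (P z) v)"
        by (intro one_less_cardI[OF fin, where p = "(\<rho> j t, Suc y)" and q = "(x, Suc y)"]) auto
      then show ?thesis
        by (simp add: c1)
    qed (simp add: e)
  next
    fix z assume z: "z \<in> Z" and Fz: "F z \<noteq> {}"
    obtain j i where e: "z = (j, i)"
      by (cases z)
    have jk: "j < k" and i: "i \<le> a - 2"
      using z Fz by (auto simp: e F_def Z_iff)
    have F_eq: "F z = (if i = a - 2 then {(\<rho> j i, b + j), (\<rho> j (a - 1), b + j)} else {(\<rho> j i, b + j)})"
    proof -
      have lt: "i < a" "a - 1 < a"
        using a i by auto
      have "(x, y) \<in> F z \<longleftrightarrow> y = b + j \<and> (x = \<rho> j i \<or> (i = a - 2 \<and> x = \<rho> j (a - 1)))" for x y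
        using jk \<rho>_iff[OF lt(1), of x j] \<rho>_iff[OF lt(2), of x j] by (auto simp: e F_iff)
      then show ?thesis
        by auto
    qed
    have reach: "reach (block a b k) (P z) v =
      (if i = 0 then {(\<rho> j 0, b + Suc j), (\<rho> j 1, b + Suc j)} else {(\<rho> j (Suc i), b + Suc j)})"
      if "v \<in> F z" for v
      using that reach_F[of j i "fst v"] z by (cases v) (auto simp: e F_iff)
    have U: "(\<Union>v\<in>F z. reach (block a b k) (P z) v) =
      (if i = 0 then {(\<rho> j 0, b + Suc j), (\<rho> j 1, b + Suc j)} else {(\<rho> j (Suc i), b + Suc j)})"
      using reach Fz by auto
    show "nx z \<in> Z"
      using jk i by (auto simp: e nx_def Z_iff)
    show "R (nx z) \<subseteq> R z \<union> (\<Union>v\<in>F z. before a b v)"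
      using F_eq a by (auto simp: e nx_def R_def before_def near_def \<rho>_0)
    have inv: "x = \<rho> j t \<longleftrightarrow> \<rho> j x = t" if "x < a" "t < a" for x t
      using that \<rho>_\<rho> by auto
    show "P (nx z) = P z \<union> (\<Union>v\<in>F z. reach (block a b k) (P z) v)"
    proof (rule set_eqI)
      fix w :: "nat \<times> nat"
      obtain x y where w: "w = (x, y)"
        by (cases w)
      show "w \<in> P (nx z) \<longleftrightarrow> w \<in> P z \<union> (\<Union>v\<in>F z. reach (block a b k) (P z) v)"
      proof (cases "x < a")
        case True
        then show ?thesis
          unfolding U using a i \<rho>_less[OF True, of j] inv[OF True] by (auto simp: w e nx_def P_iff)
      next
        case False
        then show ?thesis
          unfolding U using a i \<rho>_less[of 0 j] \<rho>_less[of 1 j] \<rho>_less[of "Suc i" j]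
          by (auto simp: w e nx_def P_iff)
      qed
    qed
    fix w assume wB: "w \<in> block a b k"
    obtain x y where w: "w = (x, y)"
      by (cases w)
    have x: "x < a" "b \<le> y"
      using wB by (auto simp: w block_iff)
    \<comment> \<open>All firing vertices reach the same set, so a newly reached \<open>w\<close>
      receives one searcher from each of them: two when \<open>i = a - 2\<close>, which is the new
      pair.\<close>
    have "{v \<in> F z. w \<in> reach (block a b k) (P z) v} =
        (if w \<in> (\<Union>v\<in>F z. reach (block a b k) (P z) v) then F z else {})"
      using reach by auto
    moreover have "card (F z) = (if i = a - 2 then 2 else 1)"
      using F_eq inv[of "\<rho> j i" "a - 1"] \<rho>_less[of i j] \<rho>_\<rho>[of i j] a by auto
    ultimately have card: "card {v \<in> F z. w \<in> reach (block a b k) (P z) v} =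
       (if y = b + Suc j \<and> (if i = 0 then \<rho> j x = 0 \<or> \<rho> j x = 1 else \<rho> j x = Suc i)
        then if i = a - 2 then 2 else 1 else 0)"
      unfolding U using a i inv[OF x(1)] by (auto simp: w)
    \<comment> \<open>After the last firing of a column the pair is in row \<open>a - 1\<close>,
      counted by \<open>\<rho> j\<close>, which is row 0 counted by
      \<open>\<rho> (Suc j)\<close>.\<close>
    show "c (nx z) w = (if w \<in> P z then (if w \<in> F z then 0 else c z w)
        else card {v \<in> F z. w \<in> reach (block a b k) (P z) v})"
      unfolding card using a i jk x \<rho>_less[OF x(1), of j] \<rho>_Suc[OF x(1), of j]
      by (auto simp: w e nx_def P_iff F_iff c_eq)
  next
    fix z assume z: "z \<in> Z" and Fz: "F z = {}"
    obtain j i where e: "z = (j, i)"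
      by (cases z)
    have lt: "i < a"
      using z a by (auto simp: e Z_iff)
    \<comment> \<open>In any other state row \<open>i\<close> of column \<open>b + j\<close> is
      ready to fire.\<close>
    have "j = k \<and> i = 0"
    proof (rule ccontr)
      assume "\<not> (j = k \<and> i = 0)"
      then have "(\<rho> j i, b + j) \<in> F z"
        using z \<rho>_less[OF lt, of j] \<rho>_\<rho>[OF lt, of j] by (auto simp: e F_iff Z_iff)
      then show False
        using Fz by simp
    qed
    then show "P z = block a b k"
      by (auto simp: e P_iff block_iff)
  qed
  have "sum (c (0, 0)) (block a b k) = (\<Sum>v\<in>{..<a} \<times> {b}. if fst v = 0 then 2 else (1 :: nat))"
    by (rule sum.mono_neutral_cong_right) (auto simp: block_def c_eq \<rho>_0 split: if_splits)
  also have "\<dots> = (\<Sum>x<a. if x = 0 then 2 else 1)"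
    by (rule sum.reindex_bij_witness[where i = "\<lambda>x. (x, b)" and j = fst]) auto
  also have "\<dots> = a + 1"
    using a by (cases a) (simp_all add: sum.lessThan_Suc_shift del: sum.lessThan_Suc)
  finally show ?thesis
    using extension by simp
qed

section \<open>Cutting the grid into strips\<close>

lemma deduction_number_strips:
  assumes "\<And>b. deduction_number k (path_graph a \<boxtimes> path_graph (b + Suc k))
    \<le> deduction_number k (path_graph a \<boxtimes> path_graph b) + t"
  shows "deduction_number k (path_graph a \<boxtimes> path_graph n)
    \<le> deduction_number k (path_graph a \<boxtimes> path_graph (n mod Suc k)) + t * (n div Suc k)"
proof -
  have "deduction_number k (path_graph a \<boxtimes> path_graph (b + q * Suc k))
    \<le> deduction_number k (path_graph a \<boxtimes> path_graph b) + t * q" for b q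
  proof (induction q)
    case (Suc q)
    have eq: "b + Suc q * Suc k = (b + q * Suc k) + Suc k" "t * Suc q = t * q + t"
      by simp_all
    show ?case
      unfolding eq using order_trans[OF assms add_right_mono[OF Suc.IH]] by (simp only: add.assoc)
  qed simp
  from this[of "n mod Suc k" "n div Suc k"] show ?thesis
    by (simp only: mod_div_mult_eq)
qed

text \<open>The left side counts the paths of \<open>c\<close> vertices cut from a path of
  \<open>m\<close> vertices, with one more for a nonempty remainder.\<close>

lemma div_le_ceiling:
  fixes m c :: nat
  assumes "0 < c"
  shows "m div c + (if m mod c = 0 then 0 else 1) \<le> nat \<lceil>real m / real c\<rceil>"
proof -
  have "real m = real (m div c) * real c + real (m mod c)"
    by (metis div_mult_mod_eq of_nat_add of_nat_mult)
  then have "real m / real c = real (m div c) + real (m mod c) / real c"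
    using assms by (simp add: field_simps)
  moreover have "0 < real (m mod c) / real c" if "m mod c \<noteq> 0"
    using assms that by simp
  ultimately have "real_of_int (int (m div c + (if m mod c = 0 then 0 else 1)) - 1) < real m / real c"
    by auto
  then have "int (m div c + (if m mod c = 0 then 0 else 1)) - 1 < \<lceil>real m / real c\<rceil>"
    by (simp only: less_ceiling_iff)
  then show ?thesis
    by linarith
qed

theorem theorem5p6:
  fixes k m n r s :: nat
  assumes "3 \<le> k" and "3 \<le> m" and "m \<le> n" and "k + 1 < n"
    and "r = m mod (k + 1)" and "s = n mod (k + 1)"
  shows "deduction_number k (path_graph m \<boxtimes> path_graph n) \<le>
    (if s = 0 then (m + 1) * (n div (k + 1))
     else if s = 1 then (m + 1) * (n div (k + 1)) + nat \<lceil>real m / real (k + 1)\<rceil>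
     else if s = 2 then (m + 1) * (n div (k + 1)) + 4 * (m div (k + 1))
       + deduction_number k (path_graph r \<boxtimes> path_graph s)
     else (m + 1) * (n div (k + 1)) + (s + 1) * (m div (k + 1))
       + deduction_number k (path_graph r \<boxtimes> path_graph s))"
proof -
  let ?d = "\<lambda>a b. deduction_number k (path_graph a \<boxtimes> path_graph b)"
  have k: "0 < k"
    using assms by simp
  \<comment> \<open>Strips of \<open>k + 1\<close> columns, each with \<open>m\<close> rows, are
    removed until \<open>s\<close> columns are left.\<close>
  have wide: "?d m n \<le> ?d m s + (m + 1) * (n div (k + 1))"
    using deduction_number_strips[OF zigzag_extension[OF assms(2) k], of n] assms(6) by simp
  \<comment> \<open>The remaining \<open>m\<close> by \<open>s\<close> grid is turned around, so
    that its rows can be removed in strips of \<open>k + 1\<close> by a sweep on \<open>s\<close>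
    rows.\<close>
  have tall: "?d m s \<le> ?d s r + t * (m div (k + 1))"
    if "\<And>b. ?d s (b + Suc k) \<le> ?d s b + t" for t
    using deduction_number_strips[OF that, of m] deduction_number_grid_swap[of k m s] assms(5) by simp
  have swap: "?d s r \<le> ?d r s"
    by (rule deduction_number_grid_swap)
  consider "s = 0" | "s = 1" | "s = 2" | "3 \<le> s"
    by linarith
  then show ?thesis
  proof cases
    case 1
    then have "?d m s = 0"
      using deduction_number_grid_swap[of k m 0] by simp
    then show ?thesis
      using wide 1 by simp
  next
    case 2
    have "?d 1 0 = 0"
      using deduction_number_grid_swap[of k 1 0] by simp
    moreover have "r \<le> k"
      using assms(5) by (simp add: less_Suc_eq_le[symmetric])
    \<comment> \<open>The remainder has at most \<open>k\<close> vertices, so one searcher starting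
      at its end, with no old part before it, sweeps it whenever it is nonempty.\<close>
    ultimately have "?d 1 r \<le> (if r = 0 then 0 else 1)"
      using path_extension[of "r - 1" k 0] by (cases r) auto
    moreover have "?d m s \<le> ?d s r + 1 * (m div (k + 1))"
      using path_extension[of k k] k 2 by (intro tall) simp
    moreover have "m div (k + 1) + (if r = 0 then 0 else 1) \<le> nat \<lceil>real m / real (k + 1)\<rceil>"
      using div_le_ceiling[of "k + 1" m] assms(5) by simp
    ultimately have "?d m s \<le> nat \<lceil>real m / real (k + 1)\<rceil>"
      using 2 by simp
    then show ?thesis
      using wide 2 by simp
  next
    case 3
    have "?d m s \<le> ?d s r + 4 * (m div (k + 1))"
      using two_row_extension 3 by (intro tall) simp
    then show ?thesis
      using wide swap 3 by simp
  next
    case 4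
    have "?d m s \<le> ?d s r + (s + 1) * (m div (k + 1))"
      by (intro tall zigzag_extension 4 k)
    then show ?thesis
      using wide swap 4 by simp
  qed
qed

end
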